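(* Assume: $(A,B)$ is stabilizable; $\mathcal{Y}\subseteq\mathbb{R}^{n_y}$ is a compact polyhedron with $0\in\mathrm{Int}\,\mathcal{Y}$; $G_z$ has full rank; $Q=Q^T\succeq0$ with $(A,Q)$ observable and $R=R^T\succ0$; $P=P^T\succeq 0$ and, for all $(x,v)\in\mathcal{T}$, with $\delta x=x-\bar x_v$, $\|(A-BK)\delta x\|_P^2-\|\delta x\|_P^2\le-\|\delta x\|^2_{Q+K^TRK}$; and for all $(x,v)\in\mathcal{T}$, $(Ax+B\kappa_N(x,v),v)\in\mathcal{T}$ and $Cx+D\kappa_N(x,v)\in\mathcal{Y}$. Let $\mathcal{F}\subseteq\Gamma_N$ be closed, convex and polyhedral, and let $r\in\mathbb{R}^{n_z}$ be a constant reference. Consider the closed-loop system with $v_0=\bar g(x_0)$ and, for $k\in\mathbb{N}$, $$x_{k+1}=f(x_k,v_k),\qquad v_{k+1}=g(x_{k+1},v_k),\qquad y_k=Cx_k+D\kappa(x_k,v_k).$$ If $x_0\in\Pi_x\Phi$, then the sequence $\{(x_k,v_k)\}_{k=0}^\infty\subseteq\Lambda$ is well defined and $y_k\in\mathcal{Y}$ for all $k\in\mathbb{N}$.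
   Context: System: $x_{k+1}=Ax_k+Bu_k$, $y_k=Cx_k+Du_k$, $z_k=Ex_k+Fu_k$, with $x_k\in\mathbb{R}^{n_x}$, $u_k\in\mathbb{R}^{n_u}$, constrained output $y_k\in\mathbb{R}^{n_y}$, tracking output $z_k\in\mathbb{R}^{n_z}$. $\mathbb{N}$ includes $0$. Constraint: $y_k\in\mathcal{Y}$. Equilibria: let $Z=\begin{bmatrix} A-I & B & 0 \\ E & F & -I \end{bmatrix}$ and let $G=[G_x^T\ G_u^T\ G_z^T]^T$ be a matrix with $n_v$ columns forming a basis of $\ker Z$ (block rows of sizes $n_x,n_u,n_z$). For $v\in\mathbb{R}^{n_v}$ put $\bar x_v=G_xv$, $\bar u_v=G_uv$, $\bar z_v=G_zv$. Let $G_y=CG_x+DG_u$, fix $\epsilon\in(0,1)$, and let $\mathcal{V}_\epsilon=\{v\in\mathbb{R}^{n_v}\mid G_yv\in(1-\epsilon)\mathcal{Y}\}$. MPC: $N\ge1$ is the horizon, $\mathcal{T}\subseteq\mathbb{R}^{n_x}\times\mathbb{R}^{n_v}$ is a polyhedral terminal set, $K\in\mathbb{R}^{n_u\times n_x}$ is a gain, $\kappa_N(x,v)=\bar u_v-K(x-\bar x_v)$, and $\|x\|_P=\sqrt{x^TPx}$. The optimal control problem with parameter $(x,v)$ is to minimize over $\mu=(\mu_0,\dots,\mu_{N-1})$ the cost $\|\xi_N-\bar x_v\|_P^2+\sum_{i=0}^{N-1}\left(\|\xi_i-\bar x_v\|_Q^2+\|\mu_i-\bar u_v\|_R^2\right)$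 subject to $\xi_0=x$, $\xi_{i+1}=A\xi_i+B\mu_i$, $C\xi_i+D\mu_i\in\mathcal{Y}$ for $i=0,\dots,N-1$, and $(\xi_N,v)\in\mathcal{T}$. $\Gamma_N$ is the set of $(x,v)$ for which these constraints are feasible. For $(x,v)\in\Gamma_N$, $\kappa(x,v)=\mu_0^\star(x,v)$ is the first element of the minimizer, and $f(x,v)=Ax+B\kappa(x,v)$. Feasibility Governor: let $\psi(v,r)=\|G_zv-r\|_2^2$ if $G_z$ is injective, and $\psi(v,r)=\|v-v_r^*\|_2^2$ otherwise, where $v_r^*$ is a fixed chosen element of $\mathrm{argmin}_{v\in\mathcal{V}_\epsilon}\|G_zv-r\|_2^2$. Let $\Phi=\mathcal{F}\cap(\mathbb{R}^{n_x}\times\mathcal{V}_\epsilon)$, $\Lambda=\Gamma_N\cap(\mathbb{R}^{n_x}\times\mathcal{V}_\epsilon)$, $\Pi_x\Phi=\{x\mid\exists v:(x,v)\in\Phi\}$. For $x\in\Pi_x\Phi$, $\bar g(x)=\mathrm{argmin}\{\psi(v,r)\mid (x,v)\in\Phi\}$; and $g(x,v)=\bar g(x)$ if $(x,v)\in\Phi$, $g(x,v)=v$ if $(x,v)\in\Lambda\setminus\Phi$. *)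

theory Defs
  imports "HOL-Analysis.Analysis"
begin

(* Eigenvalues are taken over the complex numbers. *)
definition schur_stable :: "real^'n^'n \<Rightarrow> bool" where
  "schur_stable M \<longleftrightarrow>
     (\<forall>(l::complex) w. w \<noteq> 0 \<and> map_matrix complex_of_real M *v w = l *s w \<longrightarrow> cmod l < 1)"

definition stabilizable :: "real^'n^'n \<Rightarrow> real^'m^'n \<Rightarrow> bool" where
  "stabilizable A B \<longleftrightarrow> (\<exists>L :: real^'n^'m. schur_stable (A - B ** L))"

(* Finitely many outputs C A^k x of the unforced system determine the initial state x. *)
definition observable :: "real^'n^'n \<Rightarrow> real^'n^'p \<Rightarrow> bool" where
  "observable A C \<longleftrightarrow>
     (\<exists>t::nat. \<forall>x x'. (\<forall>k<t. C *v (((*v) A ^^ k) x) = C *v (((*v) A ^^ k) x')) \<longrightarrow> x = x')"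

definition sym_psd :: "real^'n^'n \<Rightarrow> bool" where
  "sym_psd M \<longleftrightarrow> transpose M = M \<and> (\<forall>x. 0 \<le> x \<bullet> (M *v x))"

definition sym_pd :: "real^'n^'n \<Rightarrow> bool" where
  "sym_pd M \<longleftrightarrow> transpose M = M \<and> (\<forall>x. x \<noteq> 0 \<longrightarrow> 0 < x \<bullet> (M *v x))"

definition wnorm :: "real^'n^'n \<Rightarrow> real^'n \<Rightarrow> real" where
  "wnorm P x = sqrt (x \<bullet> (P *v x))"

(* The block matrix [A - I, B, 0; E, F, -I], with blocks indexed by sum types. *)
definition equilibrium_matrix ::
  "real^'x^'x \<Rightarrow> real^'u^'x \<Rightarrow> real^'x^'z \<Rightarrow> real^'u^'z \<Rightarrow> real^('x::finite + 'u::finite + 'z::finite)^('x + 'z)" where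
  "equilibrium_matrix A B E F = (\<chi> p q.
     case p of
       Inl i \<Rightarrow> (case q of
           Inl j \<Rightarrow> (A - mat 1) $ i $ j
         | Inr (Inl j) \<Rightarrow> B $ i $ j
         | Inr (Inr j) \<Rightarrow> 0)
     | Inr i \<Rightarrow> (case q of
           Inl j \<Rightarrow> E $ i $ j
         | Inr (Inl j) \<Rightarrow> F $ i $ j
         | Inr (Inr j) \<Rightarrow> (- mat 1) $ i $ j))"

definition block_x :: "real^'v^('x::finite + 'u::finite + 'z::finite) \<Rightarrow> real^'v^'x" where
  "block_x G = (\<chi> i. G $ Inl i)"

definition block_u :: "real^'v^('x::finite + 'u::finite + 'z::finite) \<Rightarrow> real^'v^'u" where
  "block_u G = (\<chi> i. G $ Inr (Inl i))"

definition block_z :: "real^'v^('x::finite + 'u::finite + 'z::finite) \<Rightarrow> real^'v^'z" where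
  "block_z G = (\<chi> i. G $ Inr (Inr i))"

(* Injectivity of the column family is needed because columns G is only a set. *)
definition columns_form_basis :: "real^'v^'n \<Rightarrow> (real^'n) set \<Rightarrow> bool" where
  "columns_form_basis G S \<longleftrightarrow>
     inj (\<lambda>j. column j G) \<and> independent (columns G) \<and> span (columns G) = S"

primrec predict ::
  "real^'x^'x \<Rightarrow> real^'u^'x \<Rightarrow> real^'x \<Rightarrow> (nat \<Rightarrow> real^'u) \<Rightarrow> nat \<Rightarrow> real^'x" where
  "predict A B x \<mu> 0 = x"
| "predict A B x \<mu> (Suc i) = A *v predict A B x \<mu> i + B *v \<mu> i"

(* Input sequences of length N are functions that are undefined off {..<N},
   so that equality of sequences is equality of the first N entries. *)
definition ocp_feasible ::
  "real^'x^'x \<Rightarrow> real^'u^'x \<Rightarrow> real^'x^'y \<Rightarrow> real^'u^'y \<Rightarrow> (real^'y) set \<Rightarrow>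
   nat \<Rightarrow> ((real^'x) \<times> (real^'v)) set \<Rightarrow> real^'x \<Rightarrow> real^'v \<Rightarrow> (nat \<Rightarrow> real^'u) \<Rightarrow> bool" where
  "ocp_feasible A B C D \<Y> N \<T> x v \<mu> \<longleftrightarrow>
     \<mu> \<in> extensional {..<N} \<and>
     (\<forall>i<N. C *v predict A B x \<mu> i + D *v \<mu> i \<in> \<Y>) \<and>
     (predict A B x \<mu> N, v) \<in> \<T>"

(* xb and ub stand for the equilibrium state and input. *)
definition ocp_cost ::
  "real^'x^'x \<Rightarrow> real^'u^'x \<Rightarrow> real^'x^'x \<Rightarrow> real^'x^'x \<Rightarrow> real^'u^'u \<Rightarrow> nat \<Rightarrow>
   real^'x \<Rightarrow> real^'u \<Rightarrow> real^'x \<Rightarrow> (nat \<Rightarrow> real^'u) \<Rightarrow> real" where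
  "ocp_cost A B P Q R N xb ub x \<mu> =
     (wnorm P (predict A B x \<mu> N - xb))\<^sup>2 +
     (\<Sum>i<N. (wnorm Q (predict A B x \<mu> i - xb))\<^sup>2 + (wnorm R (\<mu> i - ub))\<^sup>2)"

definition governor_cost :: "real^'v^'z \<Rightarrow> real^'v \<Rightarrow> real^'z \<Rightarrow> real^'v \<Rightarrow> real" where
  "governor_cost Gz vstar r v =
     (if inj ((*v) Gz) then (norm (Gz *v v - r))\<^sup>2 else (norm (v - vstar))\<^sup>2)"

(* The governor is only specified on \<Lambda>. *)
definition governor ::
  "('x \<times> 'v) set \<Rightarrow> ('x \<times> 'v) set \<Rightarrow> ('x \<Rightarrow> 'v) \<Rightarrow> 'x \<Rightarrow> 'v \<Rightarrow> 'v" where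
  "governor \<Phi> \<Lambda> gbar x v =
     (if (x, v) \<in> \<Phi> then gbar x else if (x, v) \<in> \<Lambda> - \<Phi> then v else undefined)"

primrec closed_loop ::
  "('x \<Rightarrow> 'v \<Rightarrow> 'x) \<Rightarrow> ('x \<Rightarrow> 'v \<Rightarrow> 'v) \<Rightarrow> 'x \<Rightarrow> 'v \<Rightarrow> nat \<Rightarrow> 'x \<times> 'v" where
  "closed_loop f g x0 v0 0 = (x0, v0)"
| "closed_loop f g x0 v0 (Suc k) =
     (let (x, v) = closed_loop f g x0 v0 k; x' = f x v in (x', g x' v))"

end

theory Submission
  imports Defs
begin

text \<open>
  Both optimisation problems minimise a strictly convex quadratic over a closed convex set, so each
  has exactly one solution as soon as it has a feasible point. For the governor this is the
  projection theorem, transported along an injective linear map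
  (\<open>linear_least_squares_unique_minimizer\<close>). For the control problem, existence is a compactness
  argument and uniqueness follows from the parallelogram identity (\<open>ocp_unique_minimizer\<close>); the
  positive definite input weight supplies both coercivity and strictness.

  Feasibility propagates along the loop for a fixed reference \<open>v\<close>: dropping the first input of
  a feasible sequence and appending the terminal feedback at its end gives a feasible sequence for
  the successor state, because the terminal set is invariant and constraint admissible
  (\<open>ocp_feasible_shift\<close>). The governor changes the reference only when the current
  one already lies in the feasible set of its own problem, and then its choice lies there too.
  Hence \<open>\<Lambda>\<close> is invariant, and the output constraint is the stage constraint of
  the control problem at its first step.
\<close>

section \<open>Weighted norms\<close>

lemma sym_pd_imp_sym_psd: "sym_pd M \<Longrightarrow> sym_psd M"
  unfolding sym_pd_def sym_psd_def by (metis inner_zero_left less_eq_real_def)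

lemma wnorm_power2: "sym_psd M \<Longrightarrow> (wnorm M x)\<^sup>2 = x \<bullet> (M *v x)"
  by (simp add: wnorm_def sym_psd_def)

text \<open>The parallelogram identity in midpoint form: averaging two points lowers the quadratic by
  a term that measures how far apart they are.\<close>

lemma wnorm_power2_midpoint:
  assumes "sym_psd M"
  shows "(wnorm M ((1/2) *\<^sub>R (a + b) - c))\<^sup>2 =
         ((wnorm M (a - c))\<^sup>2 + (wnorm M (b - c))\<^sup>2) / 2 - (wnorm M ((1/2) *\<^sub>R (a - b)))\<^sup>2"
proof -
  have parallelogram: "(wnorm M ((1/2) *\<^sub>R (y + z)))\<^sup>2 =
      ((wnorm M y)\<^sup>2 + (wnorm M z)\<^sup>2) / 2 - (wnorm M ((1/2) *\<^sub>R (y - z)))\<^sup>2" for y z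
    unfolding wnorm_power2[OF assms]
    by (simp add: matrix_vector_right_distrib matrix_vector_mult_diff_distrib
        matrix_vector_mult_scaleR inner_add_left inner_add_right inner_diff_left inner_diff_right
        field_simps)
  have "(a - c) + (b - c) = (a + b) - (c + c)"
    by simp
  then have "(1/2) *\<^sub>R (a + b) - c = (1/2) *\<^sub>R ((a - c) + (b - c))"
    by (simp only: scaleR_diff_right scaleR_half_double)
  then show ?thesis
    using parallelogram[of "a - c" "b - c"] by simp
qed

text \<open>The quadratic attains a positive minimum on the unit sphere; homogeneity does the rest.\<close>

lemma sym_pd_coercive:
  fixes M :: "real^'n^'n"
  assumes "sym_pd M"
  obtains m where "m > 0" "\<And>x. m * (norm x)\<^sup>2 \<le> (wnorm M x)\<^sup>2"
proof -
  have "continuous_on (sphere 0 1) (\<lambda>x. x \<bullet> (M *v x))"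
    by (intro continuous_intros)
  moreover have "sphere (0::real^'n) 1 \<noteq> {}"
    by simp
  ultimately obtain s where s: "s \<in> sphere 0 1"
      "\<And>y. y \<in> sphere 0 1 \<Longrightarrow> s \<bullet> (M *v s) \<le> y \<bullet> (M *v y)"
    using continuous_attains_inf[OF compact_sphere, of "0::real^'n" 1 "\<lambda>x. x \<bullet> (M *v x)"] by blast
  show thesis
  proof
    show "s \<bullet> (M *v s) > 0"
      using s(1) assms unfolding sym_pd_def by (metis mem_sphere_0 norm_zero zero_neq_one)
    fix x
    show "(s \<bullet> (M *v s)) * (norm x)\<^sup>2 \<le> (wnorm M x)\<^sup>2"
    proof (cases "x = 0")
      case False
      then have "s \<bullet> (M *v s) \<le> (inverse (norm x) *\<^sub>R x) \<bullet> (M *v (inverse (norm x) *\<^sub>R x))"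
        by (intro s(2)) simp
      also have "\<dots> = (wnorm M x)\<^sup>2 / (norm x)\<^sup>2"
        using wnorm_power2[OF sym_pd_imp_sym_psd[OF assms]]
        by (simp add: matrix_vector_mult_scaleR power2_eq_square field_simps)
      finally show ?thesis
        using False by (simp add: pos_le_divide_eq)
    qed (simp add: wnorm_def)
  qed
qed

section \<open>Predicted trajectories\<close>

lemma predict_cong:
  "(\<And>i. i < n \<Longrightarrow> \<mu> i = \<nu> i) \<Longrightarrow> predict A B x \<mu> n = predict A B x \<nu> n"
  by (induction n) auto

lemma predict_Suc_shift:
  "predict A B (A *v x + B *v \<mu> 0) (\<lambda>i. \<mu> (Suc i)) n = predict A B x \<mu> (Suc n)"
  by (induction n) auto

lemma predict_midpoint:
  "predict A B x (\<lambda>i. (1/2) *\<^sub>R (\<mu> i + \<nu> i)) n =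
   (1/2) *\<^sub>R (predict A B x \<mu> n + predict A B x \<nu> n)"
proof (induction n)
  case 0
  show ?case by (simp flip: scaleR_2)
next
  case (Suc n)
  then show ?case
    by (simp add: matrix_vector_right_distrib matrix_vector_mult_scaleR algebra_simps)
qed

lemma continuous_on_matrix_vector_mult:
  fixes M :: "real^'n^'m"
  shows "continuous_on S h \<Longrightarrow> continuous_on S (\<lambda>x. M *v h x)"
  by (rule bounded_linear.continuous_on[OF matrix_vector_mul_bounded_linear])

lemma continuous_on_coordinate: "continuous_on S (\<lambda>\<mu>. \<mu> i)"
  by (rule continuous_on_product_coordinates[THEN continuous_on_subset]) simp

lemma continuous_on_predict: "continuous_on S (\<lambda>\<mu>. predict A B x \<mu> n)"
  by (induction n)
    (simp_all add: continuous_on_add continuous_on_matrix_vector_mult continuous_on_coordinate)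

section \<open>The optimal control problem\<close>

lemma convex_midpoint:
  "convex S \<Longrightarrow> a \<in> S \<Longrightarrow> b \<in> S \<Longrightarrow> (1/2) *\<^sub>R (a + b) \<in> S"
  using convexD[of S a b "1/2" "1/2"] by (simp add: scaleR_add_right)

lemma ocp_feasible_midpoint:
  assumes "convex \<Y>" "convex \<T>"
    and \<mu>: "ocp_feasible A B C D \<Y> N \<T> x v \<mu>" and \<nu>: "ocp_feasible A B C D \<Y> N \<T> x v \<nu>"
  shows "ocp_feasible A B C D \<Y> N \<T> x v (restrict (\<lambda>i. (1/2) *\<^sub>R (\<mu> i + \<nu> i)) {..<N})"
    (is "ocp_feasible _ _ _ _ _ _ _ _ _ ?m")
proof -
  have pred: "predict A B x ?m i = (1/2) *\<^sub>R (predict A B x \<mu> i + predict A B x \<nu> i)"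
    if "i \<le> N" for i
    unfolding predict_midpoint[symmetric] using that by (intro predict_cong) auto
  have "C *v predict A B x ?m i + D *v ?m i \<in> \<Y>" if "i < N" for i
  proof -
    have "C *v predict A B x ?m i + D *v ?m i =
        (1/2) *\<^sub>R ((C *v predict A B x \<mu> i + D *v \<mu> i) + (C *v predict A B x \<nu> i + D *v \<nu> i))"
      using that pred[of i]
      by (simp add: matrix_vector_right_distrib matrix_vector_mult_scaleR algebra_simps)
    then show ?thesis
      using convex_midpoint[OF \<open>convex \<Y>\<close>] \<mu> \<nu> that unfolding ocp_feasible_def by metis
  qed
  moreover have "(predict A B x ?m N, v) \<in> \<T>"
    using convex_midpoint[OF \<open>convex \<T>\<close>, of "(predict A B x \<mu> N, v)" "(predict A B x \<nu> N, v)"]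
      \<mu> \<nu> pred[of N] unfolding ocp_feasible_def
    by (simp add: scaleR_add_right flip: scaleR_add_left)
  ultimately show ?thesis
    unfolding ocp_feasible_def by simp
qed

text \<open>Every term of the cost is midpoint convex, and a stage at which the two input sequences
  differ makes its input term strictly so.\<close>

lemma ocp_cost_midpoint_less:
  assumes "sym_psd P" "sym_psd Q" "sym_pd R"
    and "\<mu> \<in> extensional {..<N}" "\<nu> \<in> extensional {..<N}" "\<mu> \<noteq> \<nu>"
  shows "ocp_cost A B P Q R N xb ub x (restrict (\<lambda>i. (1/2) *\<^sub>R (\<mu> i + \<nu> i)) {..<N})
       < (ocp_cost A B P Q R N xb ub x \<mu> + ocp_cost A B P Q R N xb ub x \<nu>) / 2"
    (is "ocp_cost _ _ _ _ _ _ _ _ _ ?m < _")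
proof -
  note R = sym_pd_imp_sym_psd[OF \<open>sym_pd R\<close>]
  have pred: "predict A B x ?m i = (1/2) *\<^sub>R (predict A B x \<mu> i + predict A B x \<nu> i)"
    if "i \<le> N" for i
    unfolding predict_midpoint[symmetric] using that by (intro predict_cong) auto
  define s where "s \<mu> i = (wnorm Q (predict A B x \<mu> i - xb))\<^sup>2 + (wnorm R (\<mu> i - ub))\<^sup>2" for \<mu> i
  have stage: "s ?m i \<le> (s \<mu> i + s \<nu> i) / 2 - (wnorm R ((1/2) *\<^sub>R (\<mu> i - \<nu> i)))\<^sup>2" if "i < N" for i
  proof -
    have mid: "?m i = (1/2) *\<^sub>R (\<mu> i + \<nu> i)"
      using that by simp
    have drop: "(a + b) / 2 - q + ((c + d) / 2 - p) \<le> (a + c + (b + d)) / 2 - p"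
      if "0 \<le> q" for a b c d p q :: real
      using that by (simp add: field_simps)
    show ?thesis
      unfolding s_def pred[OF less_imp_le[OF that]] mid wnorm_power2_midpoint[OF \<open>sym_psd Q\<close>]
        wnorm_power2_midpoint[OF R]
      by (rule drop) simp
  qed
  \<comment> \<open>Both sequences are undefined from \<open>N\<close> on, so they must differ at an actual stage.\<close>
  obtain j where j: "j < N" "\<mu> j \<noteq> \<nu> j"
    using assms(4-6) by (metis extensionalityI lessThan_iff)
  have "0 < (wnorm R ((1/2) *\<^sub>R (\<mu> j - \<nu> j)))\<^sup>2"
    unfolding wnorm_power2[OF R]
    by (rule \<open>sym_pd R\<close>[unfolded sym_pd_def, THEN conjunct2, rule_format]) (use j(2) in simp)
  then have strict: "s ?m j < (s \<mu> j + s \<nu> j) / 2"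
    using stage[OF j(1)] by linarith
  have weak: "s ?m i \<le> (s \<mu> i + s \<nu> i) / 2" if "i < N" for i
    using stage[OF that] by (smt (verit) zero_le_power2)
  have add: "p + q < (p1 + q1 + (p2 + q2)) / 2"
    if "q < (q1 + q2) / 2" "p \<le> (p1 + p2) / 2" for p p1 p2 q q1 q2 :: real
    using that by (simp add: field_simps)
  have "(\<Sum>i<N. s ?m i) < (\<Sum>i<N. (s \<mu> i + s \<nu> i) / 2)"
    using j(1) strict weak by (intro sum_strict_mono_ex1) auto
  also have "\<dots> = ((\<Sum>i<N. s \<mu> i) + (\<Sum>i<N. s \<nu> i)) / 2"
    by (simp only: sum.distrib sum_divide_distrib[symmetric])
  finally have "(\<Sum>i<N. s ?m i) < \<dots>" .
  moreover have "(wnorm P (predict A B x ?m N - xb))\<^sup>2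
      \<le> ((wnorm P (predict A B x \<mu> N - xb))\<^sup>2 + (wnorm P (predict A B x \<nu> N - xb))\<^sup>2) / 2"
    unfolding pred[OF order_refl] wnorm_power2_midpoint[OF \<open>sym_psd P\<close>]
    by (simp only: diff_le_eq le_add_same_cancel1 zero_le_power2)
  ultimately show ?thesis
    unfolding ocp_cost_def s_def[symmetric] by (rule add)
qed

text \<open>Input sequences have no norm, so compactness is taken in the product topology: a sublevel
  set of the cost bounds each of the first \<open>N\<close> inputs, and the others are constant.\<close>

lemma ocp_minimizer_exists:
  fixes A :: "real^'x^'x" and B :: "real^'u^'x"
  assumes "sym_psd P" "sym_psd Q" "sym_pd R" "closed \<Y>" "closed \<T>"
    and feas: "ocp_feasible A B C D \<Y> N \<T> x v \<mu>0"
  shows "\<exists>\<mu>. is_arg_min (ocp_cost A B P Q R N xb ub x) (ocp_feasible A B C D \<Y> N \<T> x v) \<mu>"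
proof -
  define J where "J = ocp_cost A B P Q R N xb ub x"
  note R = sym_pd_imp_sym_psd[OF \<open>sym_pd R\<close>]
  obtain m where m: "m > 0" "\<And>u. m * (norm u)\<^sup>2 \<le> (wnorm R u)\<^sup>2"
    using sym_pd_coercive[OF \<open>sym_pd R\<close>] by metis
  \<comment> \<open>An input farther than \<open>\<rho>\<close> from \<open>ub\<close> costs by itself more than the whole feasible plan
    \<open>\<mu>0\<close>.\<close>
  define \<rho> where "\<rho> = sqrt (J \<mu>0 / m)"
  define box where "box = Pi\<^sub>E UNIV (\<lambda>i. if i < N then cball ub \<rho> else {undefined})"
  have sublevel: "\<mu> \<in> box" if "\<mu> \<in> extensional {..<N}" "J \<mu> \<le> J \<mu>0" for \<mu>
  proof -
    have "dist ub (\<mu> i) \<le> \<rho>" if "i < N" for i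
    proof -
      have "m * (norm (\<mu> i - ub))\<^sup>2 \<le> (wnorm R (\<mu> i - ub))\<^sup>2"
        by (rule m)
      also have "\<dots> \<le> (wnorm Q (predict A B x \<mu> i - xb))\<^sup>2 + (wnorm R (\<mu> i - ub))\<^sup>2"
        by simp
      also have "\<dots> \<le> (\<Sum>i<N. (wnorm Q (predict A B x \<mu> i - xb))\<^sup>2 + (wnorm R (\<mu> i - ub))\<^sup>2)"
        using that by (intro member_le_sum) auto
      also have "\<dots> \<le> J \<mu>"
        unfolding J_def ocp_cost_def by simp
      finally have "(norm (\<mu> i - ub))\<^sup>2 \<le> J \<mu>0 / m"
        using \<open>J \<mu> \<le> J \<mu>0\<close> \<open>m > 0\<close> by (simp add: field_simps)
      then show ?thesis
        unfolding \<rho>_def by (simp add: dist_norm norm_minus_commute real_le_rsqrt)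
    qed
    then show ?thesis
      using that(1) unfolding box_def by (auto simp: extensional_def)
  qed
  have "compact box"
  proof -
    have "compactin (product_topology (\<lambda>i. euclidean) UNIV) box"
      unfolding box_def compactin_PiE by auto
    then show ?thesis
      unfolding euclidean_product_topology compactin_euclidean_iff .
  qed
  define S where "S = {\<mu>. (\<forall>i<N. C *v predict A B x \<mu> i + D *v \<mu> i \<in> \<Y>) \<and> (predict A B x \<mu> N, v) \<in> \<T>}"
  have stages: "closed ((\<lambda>\<mu>. C *v predict A B x \<mu> i + D *v \<mu> i) -` \<Y>)" for i
    by (intro closed_vimage \<open>closed \<Y>\<close> continuous_intros continuous_on_matrix_vector_mult
        continuous_on_predict continuous_on_coordinate)
  have terminal: "closed ((\<lambda>\<mu>. (predict A B x \<mu> N, v)) -` \<T>)"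
    by (intro closed_vimage \<open>closed \<T>\<close> continuous_intros continuous_on_predict)
  have S_eq: "S = (\<Inter>i\<in>{..<N}. (\<lambda>\<mu>. C *v predict A B x \<mu> i + D *v \<mu> i) -` \<Y>)
      \<inter> (\<lambda>\<mu>. (predict A B x \<mu> N, v)) -` \<T>"
    unfolding S_def by auto
  have "closed S"
    unfolding S_eq by (intro closed_Int closed_INT ballI stages terminal)
  then have "compact (box \<inter> S)"
    by (rule compact_Int_closed[OF \<open>compact box\<close>])
  moreover have ext: "box \<subseteq> extensional {..<N}"
    unfolding box_def extensional_def by (auto simp: PiE_iff) (metis singletonD)
  moreover have "\<mu>0 \<in> box \<inter> S"
    using feas sublevel unfolding ocp_feasible_def S_def by auto
  moreover have "continuous_on (box \<inter> S) J"
    unfolding J_def ocp_cost_def wnorm_def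
    by (intro continuous_intros continuous_on_matrix_vector_mult
        continuous_on_predict continuous_on_coordinate)
  ultimately obtain \<mu> where \<mu>: "\<mu> \<in> box \<inter> S" "\<And>\<nu>. \<nu> \<in> box \<inter> S \<Longrightarrow> J \<mu> \<le> J \<nu>"
    using continuous_attains_inf[of "box \<inter> S" J] by blast
  have "J \<mu> \<le> J \<nu>" if "ocp_feasible A B C D \<Y> N \<T> x v \<nu>" for \<nu>
  proof (cases "J \<nu> \<le> J \<mu>0")
    case True
    then show ?thesis
      using that sublevel \<mu>(2) unfolding ocp_feasible_def S_def by auto
  next
    case False
    then show ?thesis
      using \<mu>(2)[OF \<open>\<mu>0 \<in> box \<inter> S\<close>] by linarith
  qed
  moreover have "ocp_feasible A B C D \<Y> N \<T> x v \<mu>"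
    using \<mu>(1) ext unfolding ocp_feasible_def S_def by auto
  ultimately show ?thesis
    unfolding is_arg_min_def J_def[symmetric] by (auto simp: not_less)
qed

lemma ocp_unique_minimizer:
  assumes "sym_psd P" "sym_psd Q" "sym_pd R"
    and "closed \<Y>" "convex \<Y>" "closed \<T>" "convex \<T>"
    and "ocp_feasible A B C D \<Y> N \<T> x v \<mu>0"
  shows "\<exists>!\<mu>. is_arg_min (ocp_cost A B P Q R N xb ub x) (ocp_feasible A B C D \<Y> N \<T> x v) \<mu>"
proof (rule ex_ex1I)
  show "\<exists>\<mu>. is_arg_min (ocp_cost A B P Q R N xb ub x) (ocp_feasible A B C D \<Y> N \<T> x v) \<mu>"
    by (rule ocp_minimizer_exists[OF assms(1-4,6,8)])
next
  fix \<mu> \<nu>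
  assume \<mu>: "is_arg_min (ocp_cost A B P Q R N xb ub x) (ocp_feasible A B C D \<Y> N \<T> x v) \<mu>"
    and \<nu>: "is_arg_min (ocp_cost A B P Q R N xb ub x) (ocp_feasible A B C D \<Y> N \<T> x v) \<nu>"
  define m where "m = restrict (\<lambda>i. (1/2) *\<^sub>R (\<mu> i + \<nu> i)) {..<N}"
  let ?J = "ocp_cost A B P Q R N xb ub x"
  show "\<mu> = \<nu>"
  proof (rule ccontr)
    assume "\<mu> \<noteq> \<nu>"
    then have "?J m < (?J \<mu> + ?J \<nu>) / 2"
      using \<mu> \<nu> assms(1-3) unfolding is_arg_min_def ocp_feasible_def m_def
      by (intro ocp_cost_midpoint_less) auto
    moreover have "ocp_feasible A B C D \<Y> N \<T> x v m"
      using \<mu> \<nu> assms(5,7) unfolding is_arg_min_def m_def by (intro ocp_feasible_midpoint) auto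
    then have "?J \<mu> \<le> ?J m" "?J \<nu> \<le> ?J m"
      using \<mu> \<nu> unfolding is_arg_min_def by (meson not_less)+
    ultimately show False
      by (simp add: field_simps)
  qed
qed

text \<open>Recursive feasibility: follow the old plan for its remaining \<open>N - 1\<close> steps, which ends in
  the terminal set, and close with an input \<open>w\<close> that keeps the state there.\<close>

lemma ocp_feasible_shift:
  assumes feas: "ocp_feasible A B C D \<Y> N \<T> x v \<mu>" and "1 \<le> N"
    and terminal: "\<And>\<xi>. (\<xi>, v) \<in> \<T> \<Longrightarrow> \<exists>w. (A *v \<xi> + B *v w, v) \<in> \<T> \<and> C *v \<xi> + D *v w \<in> \<Y>"
  shows "\<exists>\<nu>. ocp_feasible A B C D \<Y> N \<T> (A *v x + B *v \<mu> 0) v \<nu>"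
proof -
  obtain n where N: "N = Suc n"
    using \<open>1 \<le> N\<close> by (cases N) auto
  have end_in: "(predict A B x \<mu> (Suc n), v) \<in> \<T>"
    using feas unfolding ocp_feasible_def N by blast
  then obtain w where w: "(A *v predict A B x \<mu> (Suc n) + B *v w, v) \<in> \<T>"
      "C *v predict A B x \<mu> (Suc n) + D *v w \<in> \<Y>"
    using terminal by blast
  define \<nu> where "\<nu> = restrict (\<lambda>i. if i < n then \<mu> (Suc i) else w) {..<N}"
  have pred: "predict A B (A *v x + B *v \<mu> 0) \<nu> i = predict A B x \<mu> (Suc i)" if "i \<le> n" for i
    unfolding predict_Suc_shift[symmetric] \<nu>_def using that N by (intro predict_cong) auto
  have last: "\<nu> n = w"
    unfolding \<nu>_def N by simp
  have "C *v predict A B (A *v x + B *v \<mu> 0) \<nu> i + D *v \<nu> i \<in> \<Y>" if "i < N" for i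
  proof (cases "i = n")
    case True
    then show ?thesis
      using w(2) pred[of n] last by simp
  next
    case False
    then have "i < n"
      using that N by simp
    then have "\<nu> i = \<mu> (Suc i)" "Suc i < N"
      unfolding \<nu>_def N by auto
    then show ?thesis
      using feas pred[of i] \<open>i < n\<close> unfolding ocp_feasible_def by (metis less_imp_le_nat)
  qed
  moreover have "(predict A B (A *v x + B *v \<mu> 0) \<nu> N, v) \<in> \<T>"
    using w(1) pred[of n] last unfolding N by simp
  moreover have "\<nu> \<in> extensional {..<N}"
    unfolding \<nu>_def by simp
  ultimately show ?thesis
    unfolding ocp_feasible_def by blast
qed

section \<open>The feasibility governor\<close>

text \<open>The image of \<open>S\<close> under an injective linear map is again closed and convex, so it has
  a unique point nearest to \<open>c\<close>, and that point has a unique preimage.\<close>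

lemma linear_least_squares_unique_minimizer:
  fixes L :: "'a::euclidean_space \<Rightarrow> 'b::euclidean_space"
  assumes "linear L" "inj L" "closed S" "convex S" "S \<noteq> {}"
  shows "\<exists>!s. is_arg_min (\<lambda>s. (norm (L s - c))\<^sup>2) (\<lambda>s. s \<in> S) s"
proof -
  have image: "closed (L ` S)" "convex (L ` S)" "L ` S \<noteq> {}"
    using assms by (auto simp: closed_injective_linear_image convex_linear_image)
  have iff: "is_arg_min (\<lambda>s. (norm (L s - c))\<^sup>2) (\<lambda>s. s \<in> S) s \<longleftrightarrow>
      s \<in> S \<and> L s = closest_point (L ` S) c" for s
  proof
    assume s: "is_arg_min (\<lambda>s. (norm (L s - c))\<^sup>2) (\<lambda>s. s \<in> S) s"
    then have "\<forall>z\<in>L ` S. dist c (L s) \<le> dist c z"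
      unfolding is_arg_min_def by (auto simp: not_less dist_norm norm_minus_commute)
    then show "s \<in> S \<and> L s = closest_point (L ` S) c"
      using s image closest_point_unique[of "L ` S" "L s" c] unfolding is_arg_min_def by auto
  next
    assume s: "s \<in> S \<and> L s = closest_point (L ` S) c"
    then have "dist c (L s) \<le> dist c (L t)" if "t \<in> S" for t
      using that closest_point_le[OF image(1), of "L t" c] by auto
    then show "is_arg_min (\<lambda>s. (norm (L s - c))\<^sup>2) (\<lambda>s. s \<in> S) s"
      using s unfolding is_arg_min_def by (auto simp: not_less dist_norm norm_minus_commute)
  qed
  obtain s where "s \<in> S" "L s = closest_point (L ` S) c"
    using closest_point_in_set[OF image(1,3), of c] by auto
  then show ?thesis
    unfolding iff using \<open>inj L\<close> by (metis injD)
qed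

text \<open>In either branch of the cost the map inside the norm is injective: \<open>Gz\<close> by the case
  distinction, or the identity.\<close>

lemma governor_unique_minimizer:
  assumes "closed S" "convex S" "S \<noteq> {}"
  shows "\<exists>!v. is_arg_min (governor_cost Gz vstar r) (\<lambda>v. v \<in> S) v"
proof (cases "inj ((*v) Gz)")
  case True
  then have "governor_cost Gz vstar r = (\<lambda>v. (norm (Gz *v v - r))\<^sup>2)"
    unfolding governor_cost_def by auto
  then show ?thesis
    using linear_least_squares_unique_minimizer[OF matrix_vector_mul_linear True assms] by simp
next
  case False
  then have "governor_cost Gz vstar r = (\<lambda>v. (norm (id v - vstar))\<^sup>2)"
    unfolding governor_cost_def by auto
  then show ?thesis
    using linear_least_squares_unique_minimizer[OF linear_id inj_on_id assms] by simp
qed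

lemma closed_vertical_slice:
  fixes S :: "('a::topological_space \<times> 'b::topological_space) set"
  assumes "closed S"
  shows "closed {v. (x, v) \<in> S}"
proof -
  have "closed (Pair x -` S)"
    by (intro closed_vimage assms continuous_intros)
  then show ?thesis
    by (simp add: vimage_def)
qed

lemma convex_vertical_slice:
  assumes "convex S"
  shows "convex {v. (x, v) \<in> S}"
proof (rule convexI)
  fix a b and s t :: real
  assume *: "a \<in> {v. (x, v) \<in> S}" "b \<in> {v. (x, v) \<in> S}" "0 \<le> s" "0 \<le> t" "s + t = 1"
  then have "s *\<^sub>R (x, a) + t *\<^sub>R (x, b) \<in> S"
    by (intro convexD[OF assms]) auto
  then show "s *\<^sub>R a + t *\<^sub>R b \<in> {v. (x, v) \<in> S}"
    using * by (simp flip: scaleR_add_left)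
qed

section \<open>Closed-loop constraint satisfaction\<close>

theorem theorem2:
  fixes A :: "real^'nx^'nx" and B :: "real^'nu^'nx"
    and C :: "real^'nx^'ny" and D :: "real^'nu^'ny"
    and E :: "real^'nx^'nz" and F :: "real^'nu^'nz"
    and G :: "real^'nv^('nx::finite + 'nu::finite + 'nz::finite)"
    and Gx :: "real^'nv^'nx" and Gu :: "real^'nv^'nu" and Gz :: "real^'nv^'nz"
    and Gy :: "real^'nv^'ny"
    and K :: "real^'nx^'nu"
    and P Q :: "real^'nx^'nx" and R :: "real^'nu^'nu"
    and \<Y> :: "(real^'ny) set" and \<V> :: "(real^'nv) set"
    and \<T> \<F> \<Gamma> \<Phi> \<Lambda> :: "((real^'nx) \<times> (real^'nv)) set"
    and \<epsilon> :: real and N :: nat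
    and r :: "real^'nz" and vstar :: "real^'nv" and x0 :: "real^'nx"
    and \<kappa>N \<kappa> :: "real^'nx \<Rightarrow> real^'nv \<Rightarrow> real^'nu"
    and f :: "real^'nx \<Rightarrow> real^'nv \<Rightarrow> real^'nx"
    and g :: "real^'nx \<Rightarrow> real^'nv \<Rightarrow> real^'nv"
    and gbar :: "real^'nx \<Rightarrow> real^'nv"
    and ocp_opt :: "real^'nx \<Rightarrow> real^'nv \<Rightarrow> (nat \<Rightarrow> real^'nu) \<Rightarrow> bool"
    and gov_opt :: "real^'nx \<Rightarrow> real^'nv \<Rightarrow> bool"
    and xs :: "nat \<Rightarrow> real^'nx" and vs :: "nat \<Rightarrow> real^'nv" and ys :: "nat \<Rightarrow> real^'ny"
  assumes "columns_form_basis G {w. equilibrium_matrix A B E F *v w = 0}"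
    and "Gx = block_x G" and "Gu = block_u G" and "Gz = block_z G"
    and "Gy = C ** Gx + D ** Gu"
    and "0 < \<epsilon>" and "\<epsilon> < 1"
    and "\<V> = {v. Gy *v v \<in> (\<lambda>y. (1 - \<epsilon>) *\<^sub>R y) ` \<Y>}"
    and "1 \<le> N" and "polyhedron \<T>"
    and "\<kappa>N = (\<lambda>x v. Gu *v v - K *v (x - Gx *v v))"
    and "\<Gamma> = {(x, v). \<exists>\<mu>. ocp_feasible A B C D \<Y> N \<T> x v \<mu>}"
    and "ocp_opt = (\<lambda>x v. is_arg_min (ocp_cost A B P Q R N (Gx *v v) (Gu *v v) x)
                                     (ocp_feasible A B C D \<Y> N \<T> x v))"
    and "\<kappa> = (\<lambda>x v. (THE \<mu>. ocp_opt x v \<mu>) 0)"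
    and "f = (\<lambda>x v. A *v x + B *v \<kappa> x v)"
    and "\<Phi> = \<F> \<inter> (UNIV \<times> \<V>)" and "\<Lambda> = \<Gamma> \<inter> (UNIV \<times> \<V>)"
    and "\<not> inj ((*v) Gz) \<Longrightarrow> is_arg_min (\<lambda>v. (norm (Gz *v v - r))\<^sup>2) (\<lambda>v. v \<in> \<V>) vstar"
    and "gov_opt = (\<lambda>x. is_arg_min (governor_cost Gz vstar r) (\<lambda>v. (x, v) \<in> \<Phi>))"
    and "gbar = (\<lambda>x. THE v. gov_opt x v)"
    and "g = governor \<Phi> \<Lambda> gbar"
    and "stabilizable A B"
    and "compact \<Y>" and "polyhedron \<Y>" and "0 \<in> interior \<Y>"
    and "rank Gz = min CARD('nz) CARD('nv)"
    and "sym_psd Q" and "observable A Q" and "sym_pd R"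
    and "sym_psd P"
    and "\<And>x v. (x, v) \<in> \<T> \<Longrightarrow>
           (wnorm P ((A - B ** K) *v (x - Gx *v v)))\<^sup>2 - (wnorm P (x - Gx *v v))\<^sup>2
           \<le> - (wnorm (Q + transpose K ** R ** K) (x - Gx *v v))\<^sup>2"
    and "\<And>x v. (x, v) \<in> \<T> \<Longrightarrow> (A *v x + B *v \<kappa>N x v, v) \<in> \<T>"
    and "\<And>x v. (x, v) \<in> \<T> \<Longrightarrow> C *v x + D *v \<kappa>N x v \<in> \<Y>"
    and "\<F> \<subseteq> \<Gamma>" and "closed \<F>" and "convex \<F>" and "polyhedron \<F>"
    and "xs = (\<lambda>k. fst (closed_loop f g x0 (gbar x0) k))"
    and "vs = (\<lambda>k. snd (closed_loop f g x0 (gbar x0) k))"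
    and "ys = (\<lambda>k. C *v xs k + D *v \<kappa> (xs k) (vs k))"
    and "x0 \<in> {x. \<exists>v. (x, v) \<in> \<Phi>}"
  shows "(\<exists>!v. gov_opt x0 v) \<and>
    (\<forall>k. (xs k, vs k) \<in> \<Lambda> \<and>
         (\<exists>!\<mu>. ocp_opt (xs k) (vs k) \<mu>) \<and>
         (xs (Suc k), vs k) \<in> \<Lambda> \<and>
         ((xs (Suc k), vs k) \<in> \<Phi> \<longrightarrow> (\<exists>!v. gov_opt (xs (Suc k)) v)) \<and>
         ys k \<in> \<Y>)"
proof -
  note V_def = assms(8) and \<Gamma>_def = assms(12) and ocp_opt_def = assms(13) and \<kappa>_def = assms(14)
    and f_def = assms(15) and \<Phi>_def = assms(16) and \<Lambda>_def = assms(17) and gov_opt_def = assms(19)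
    and gbar_def = assms(20) and g_def = assms(21) and T_inv = assms(32) and T_adm = assms(33)
  have Y: "closed \<Y>" "convex \<Y>" and T: "closed \<T>" "convex \<T>"
    using \<open>polyhedron \<Y>\<close> \<open>polyhedron \<T>\<close> by (simp_all add: polyhedron_imp_closed polyhedron_imp_convex)

  have "\<V> = (*v) Gy -` ((\<lambda>y. (1 - \<epsilon>) *\<^sub>R y) ` \<Y>)"
    unfolding V_def by auto
  then have V: "closed \<V>" "convex \<V>"
    using Y closed_scaling[of \<Y> "1 - \<epsilon>"] convex_scaling[of \<Y> "1 - \<epsilon>"]
    by (auto intro!: closed_vimage convex_linear_vimage continuous_intros)
  then have "closed \<Phi>" "convex \<Phi>"
    unfolding \<Phi>_def using \<open>closed \<F>\<close> \<open>convex \<F>\<close>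
    by (auto intro!: closed_Int closed_Times convex_Int convex_Times)
  have gov: "\<exists>!v. gov_opt x v" if "(x, v) \<in> \<Phi>" for x v
  proof -
    have "{v. (x, v) \<in> \<Phi>} \<noteq> {}"
      using that by blast
    then show ?thesis
      using governor_unique_minimizer[OF closed_vertical_slice[OF \<open>closed \<Phi>\<close>]
          convex_vertical_slice[OF \<open>convex \<Phi>\<close>]]
      unfolding gov_opt_def by simp
  qed
  have gbar_in: "(x, gbar x) \<in> \<Phi>" if "(x, v) \<in> \<Phi>" for x v
    using theI'[OF gov[OF that]] unfolding gbar_def gov_opt_def is_arg_min_def by blast
  have \<Phi>_sub: "\<Phi> \<subseteq> \<Lambda>"
    unfolding \<Phi>_def \<Lambda>_def using \<open>\<F> \<subseteq> \<Gamma>\<close> by blast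

  have ocp: "\<exists>!\<mu>. ocp_opt x v \<mu>" if "(x, v) \<in> \<Lambda>" for x v
    using that ocp_unique_minimizer[OF \<open>sym_psd P\<close> \<open>sym_psd Q\<close> \<open>sym_pd R\<close> Y T]
    unfolding \<Lambda>_def \<Gamma>_def ocp_opt_def by blast
  have minimizer: "\<exists>\<mu>. ocp_feasible A B C D \<Y> N \<T> x v \<mu> \<and> \<kappa> x v = \<mu> 0" if "(x, v) \<in> \<Lambda>" for x v
    using theI'[OF ocp[OF that]] unfolding \<kappa>_def ocp_opt_def is_arg_min_def by blast
  have output_in: "C *v x + D *v \<kappa> x v \<in> \<Y>" if "(x, v) \<in> \<Lambda>" for x v
    using minimizer[OF that] \<open>1 \<le> N\<close> unfolding ocp_feasible_def
    by (metis Suc_le_eq One_nat_def predict.simps(1))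
  have step: "(f x v, v) \<in> \<Lambda>" if xv: "(x, v) \<in> \<Lambda>" for x v
  proof -
    obtain \<mu> where \<mu>: "ocp_feasible A B C D \<Y> N \<T> x v \<mu>" "\<kappa> x v = \<mu> 0"
      using minimizer[OF xv] by blast
    have "\<exists>\<nu>. ocp_feasible A B C D \<Y> N \<T> (A *v x + B *v \<mu> 0) v \<nu>"
      by (rule ocp_feasible_shift[OF \<mu>(1) \<open>1 \<le> N\<close>]) (use T_inv T_adm in blast)
    then show ?thesis
      using xv \<mu>(2) unfolding \<Lambda>_def \<Gamma>_def f_def by auto
  qed
  have update: "(x, g x v) \<in> \<Lambda>" if "(x, v) \<in> \<Lambda>" for x v
    using that gbar_in[of x v] \<Phi>_sub unfolding g_def governor_def by auto

  have xs_Suc: "xs (Suc k) = f (xs k) (vs k)" and vs_Suc: "vs (Suc k) = g (xs (Suc k)) (vs k)" for k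
    by (simp_all add: assms(38,39) Let_def split: prod.split)
  obtain v0 where v0: "(x0, v0) \<in> \<Phi>"
    using assms(41) by blast
  have inv: "(xs k, vs k) \<in> \<Lambda>" for k
  proof (induction k)
    case 0
    show ?case
      using gbar_in[OF v0] \<Phi>_sub by (auto simp: assms(38,39))
  next
    case (Suc k)
    then show ?case
      unfolding vs_Suc xs_Suc by (intro update step)
  qed
  show ?thesis
    using gov v0 inv ocp step[OF inv] output_in[OF inv] unfolding xs_Suc assms(40) by blast
qed

end
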